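(* Let $\mathcal{G}$ be a locally compact group and let $\mathcal{X}$ be a $\mathcal{G}$-space. If the index of $\mathfrak{N}(\mathcal{X},\mathcal{G})$ in $\mathcal{G}$ is finite, then $\mathfrak{Z}(\mathcal{X},\mathcal{G})=LUC(\mathcal{G})^*$.
   Context: A (left) $\mathcal{G}$-space is a locally compact Hausdorff space $\mathcal{X}$ with a continuous map $\mathcal{G}\times\mathcal{X}\to\mathcal{X}$, $(s,x)\mapsto s\cdot x$, such that $(st)\cdot x=s\cdot(t\cdot x)$ and $e\cdot x=x$ for all $s,t\in\mathcal{G}$, $x\in\mathcal{X}$, where $e$ is the identity of $\mathcal{G}$. $\mathfrak{N}(\mathcal{X},\mathcal{G})=\{s\in\mathcal{G}: s\cdot x=x \text{ for all } x\in\mathcal{X}\}$, a closed normal subgroup of $\mathcal{G}$. $C_b(\mathcal{X})$ is the space of bounded continuous complex-valued functions on $\mathcal{X}$ with the supremum norm. For $F\in C_b(\mathcal{X})$ and $s\in\mathcal{G}$ put $(l_sF)(x)=F(s\cdot x)$, and let $$LUC(\mathcal{X},\mathcal{G})=\{F\in C_b(\mathcal{X}): s\mapsto l_sF \text{ is continuous from } \mathcal{G} \text{ into } (C_b(\mathcal{X}),\|\cdot\|_\infty)\},$$ a closed subspace of $C_b(\mathcal{X})$ invariant under all $l_s$. $LUC(\mathcal{G})=LUC(\mathcal{G},\mathcal{G})$, with $\mathcal{G}$ acting on itself by left translation. For $M\in LUC(\mathcal{X},\mathcal{G})^*$ and $F\in LUC(\mathcal{X},\mathcal{G})$, the function $MF\in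 LUC(\mathcal{G})$ is given by $(MF)(s)=\langle M,l_sF\rangle$. For $m\in LUC(\mathcal{G})^*$, the functional $m\cdot M\in LUC(\mathcal{X},\mathcal{G})^*$ is given by $\langle m\cdot M,F\rangle=\langle m,MF\rangle$. Define $$\mathfrak{Z}(\mathcal{X},\mathcal{G})=\{m\in LUC(\mathcal{G})^*: M\mapsto m\cdot M \text{ is weak}^*\text{ to weak}^*\text{ continuous on } LUC(\mathcal{X},\mathcal{G})^*\}.$$ *)

theory Defs
  imports "HOL-Algebra.Coset" "HOL-Analysis.Analysis"
begin

locale locally_compact_group = group G
  for G :: "('g, 'b) monoid_scheme" (structure) and T :: "'g topology" +
  assumes topspace_eq: "topspace T = carrier G"
    and continuous_mult: "continuous_map (prod_topology T T) T (\<lambda>(s, t). s \<otimes> t)"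
    and continuous_inv: "continuous_map T T (\<lambda>s. inv s)"
    and locally_compact_group_space: "locally_compact_space T"
    and Hausdorff_group_space: "Hausdorff_space T"

locale G_space = locally_compact_group G T
  for G :: "('g, 'b) monoid_scheme" (structure) and T :: "'g topology" +
  fixes X :: "'x topology" and act :: "'g \<Rightarrow> 'x \<Rightarrow> 'x"
  assumes locally_compact_X: "locally_compact_space X"
    and Hausdorff_X: "Hausdorff_space X"
    and continuous_act: "continuous_map (prod_topology T X) X (\<lambda>(s, x). act s x)"
    and act_mult: "\<lbrakk>s \<in> carrier G; t \<in> carrier G; x \<in> topspace X\<rbrakk>
      \<Longrightarrow> act (s \<otimes> t) x = act s (act t x)"
    and act_one: "x \<in> topspace X \<Longrightarrow> act \<one> x = x"

lemma (in locally_compact_group) left_translation_G_space: "G_space G T T (\<otimes>)"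
  by unfold_locales
    (auto simp: topspace_eq m_assoc continuous_mult locally_compact_group_space
      Hausdorff_group_space)

definition act_kernel ::
  "('g, 'b) monoid_scheme \<Rightarrow> 'x topology \<Rightarrow> ('g \<Rightarrow> 'x \<Rightarrow> 'x) \<Rightarrow> 'g set"
  where "act_kernel G X act = {s \<in> carrier G. \<forall>x \<in> topspace X. act s x = x}"

text \<open>
  Elements of \<open>mspace (C\<^sub>b X)\<close> are functions extensional on \<open>topspace X\<close>, and the metric is
  the one induced by the supremum norm. Accordingly all pointwise operations below are
  restricted to the carrier, and functionals on a space of functions \<open>V\<close> are extensional
  on \<open>V\<close>, so that equality of functionals is equality on \<open>V\<close>.
\<close>

abbreviation Cb :: "'x topology \<Rightarrow> ('x \<Rightarrow> complex) metric" ("C\<^sub>b")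
  where "C\<^sub>b X \<equiv> cfunspace X euclidean_metric"

definition left_translate ::
  "'x topology \<Rightarrow> ('g \<Rightarrow> 'x \<Rightarrow> 'x) \<Rightarrow> 'g \<Rightarrow> ('x \<Rightarrow> complex) \<Rightarrow> ('x \<Rightarrow> complex)"
  where "left_translate X act s F = (\<lambda>x \<in> topspace X. F (act s x))"

definition LUC :: "'g topology \<Rightarrow> 'x topology \<Rightarrow> ('g \<Rightarrow> 'x \<Rightarrow> 'x) \<Rightarrow> ('x \<Rightarrow> complex) set"
  where "LUC T X act =
    {F \<in> mspace (C\<^sub>b X).
       continuous_map T (mtopology_of (C\<^sub>b X)) (\<lambda>s. left_translate X act s F)}"

abbreviation LUC_group :: "('g, 'b) monoid_scheme \<Rightarrow> 'g topology \<Rightarrow> ('g \<Rightarrow> complex) set"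
  where "LUC_group G T \<equiv> LUC T T (\<lambda>s t. s \<otimes>\<^bsub>G\<^esub> t)"

text \<open>The continuous complex-linear functionals on a linear subspace \<open>V\<close> of \<open>C\<^sub>b X\<close>.\<close>

definition dual :: "'x topology \<Rightarrow> ('x \<Rightarrow> complex) set \<Rightarrow> (('x \<Rightarrow> complex) \<Rightarrow> complex) set"
  where "dual X V =
    {M \<in> extensional V.
       (\<forall>F \<in> V. \<forall>H \<in> V. M (\<lambda>x \<in> topspace X. F x + H x) = M F + M H) \<and>
       (\<forall>c. \<forall>F \<in> V. M (\<lambda>x \<in> topspace X. c * F x) = c * M F) \<and>
       continuous_map (subtopology (mtopology_of (C\<^sub>b X)) V) euclidean M}"

text \<open>
  Since \<open>dual X V\<close> consists of extensional functions on \<open>V\<close>, it is a subset of the product of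
  copies of the complex plane indexed by \<open>V\<close>; the topology it inherits is that of pointwise
  convergence on \<open>V\<close>.
\<close>

definition weak_star ::
  "'x topology \<Rightarrow> ('x \<Rightarrow> complex) set \<Rightarrow> (('x \<Rightarrow> complex) \<Rightarrow> complex) topology"
  where "weak_star X V = subtopology (product_topology (\<lambda>_. euclidean) V) (dual X V)"

text \<open>
  With \<open>M\<close> in the dual of \<open>LUC T X act\<close>, the next two definitions give \<open>M F\<close>, a function on
  the group, and the functional \<open>m \<cdot> M\<close>, for \<open>m\<close> in the dual of \<open>LUC_group G T\<close>.
\<close>

definition functional_fun :: "'g topology \<Rightarrow> 'x topology \<Rightarrow> ('g \<Rightarrow> 'x \<Rightarrow> 'x) \<Rightarrow>
    (('x \<Rightarrow> complex) \<Rightarrow> complex) \<Rightarrow> ('x \<Rightarrow> complex) \<Rightarrow> ('g \<Rightarrow> complex)"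
  where "functional_fun T X act M F = (\<lambda>s \<in> topspace T. M (left_translate X act s F))"

definition functional_mult :: "'g topology \<Rightarrow> 'x topology \<Rightarrow> ('g \<Rightarrow> 'x \<Rightarrow> 'x) \<Rightarrow>
    (('g \<Rightarrow> complex) \<Rightarrow> complex) \<Rightarrow> (('x \<Rightarrow> complex) \<Rightarrow> complex) \<Rightarrow>
    (('x \<Rightarrow> complex) \<Rightarrow> complex)"
  where "functional_mult T X act m M = (\<lambda>F \<in> LUC T X act. m (functional_fun T X act M F))"

definition topological_centre :: "('g, 'b) monoid_scheme \<Rightarrow> 'g topology \<Rightarrow> 'x topology \<Rightarrow>
    ('g \<Rightarrow> 'x \<Rightarrow> 'x) \<Rightarrow> (('g \<Rightarrow> complex) \<Rightarrow> complex) set"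
  where "topological_centre G T X act =
    {m \<in> dual T (LUC_group G T).
       continuous_map (weak_star X (LUC T X act)) (weak_star X (LUC T X act))
         (functional_mult T X act m)}"

end

theory Submission
  imports Defs
begin

text \<open>
  Write \<open>N\<close> for the kernel of the action. It is closed, so having finite index it is open. Since
  \<open>s \<mapsto> l\<^sub>s F\<close> is constant on the right cosets of \<open>N\<close>, it is locally constant, whence
  \<open>LUC(X, G) = C\<^sub>b(X)\<close>, and \<open>MF = (\<Sum>C. \<langle>M, l\<^sub>C F\<rangle> 1\<^sub>C)\<close>, where \<open>C\<close> runs over
  the cosets and \<open>l\<^sub>C\<close> is translation by a representative of \<open>C\<close>. Thus
  \<open>\<langle>m \<cdot> M, F\<rangle> = (\<Sum>C. \<langle>M, l\<^sub>C F\<rangle> \<langle>m, 1\<^sub>C\<rangle>)\<close> is a finite linear combination of weak*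
  continuous functions of \<open>M\<close>.
\<close>

section \<open>Bounded continuous functions and their pointwise operations\<close>

lemma mspace_Cb_iff:
  "F \<in> mspace (C\<^sub>b X) \<longleftrightarrow>
    F \<in> extensional (topspace X) \<and> bounded (F ` topspace X) \<and> continuous_map X euclidean F"
proof -
  \<comment> \<open>Both notions of boundedness amount to a bound on the distances between any two
    points of the set.\<close>
  have "Metric_space.mbounded UNIV dist S \<longleftrightarrow> bounded S" for S :: "complex set"
    using Met_TC.mbounded_alt[of S] by (simp add: bounded_two_points)
  then show ?thesis
    by auto
qed

lemma Cb_add:
  assumes "F \<in> mspace (C\<^sub>b X)" "H \<in> mspace (C\<^sub>b X)"
  shows "(\<lambda>x \<in> topspace X. F x + H x) \<in> mspace (C\<^sub>b X)"
proof -
  have "continuous_map X euclidean (\<lambda>x \<in> topspace X. F x + H x)"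
    by (rule continuous_map_eq[OF continuous_map_add]) (use assms in \<open>auto simp: mspace_Cb_iff\<close>)
  then show ?thesis
    using assms unfolding mspace_Cb_iff by (auto intro: bounded_plus_comp)
qed

lemma Cb_cmult:
  assumes "F \<in> mspace (C\<^sub>b X)"
  shows "(\<lambda>x \<in> topspace X. c * F x) \<in> mspace (C\<^sub>b X)"
proof -
  have F: "bounded (F ` topspace X)" "continuous_map X euclidean F"
    using assms by (simp_all only: mspace_Cb_iff)
  have "continuous_map X euclidean ((*) c \<circ> F)"
    using F(2) by (rule continuous_map_compose) (auto intro!: continuous_intros)
  then have "continuous_map X euclidean (\<lambda>x \<in> topspace X. c * F x)"
    by (rule continuous_map_eq) simp
  moreover have "bounded ((\<lambda>x. c * F x) ` topspace X)"
    using bounded_linear_image[OF F(1) bounded_linear_mult_right[of c]] by (simp add: image_image)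
  ultimately show ?thesis
    unfolding mspace_Cb_iff by simp
qed

section \<open>Right cosets and functions invariant under a subgroup\<close>

context group
begin

text \<open>A right coset absorbs left factors from \<open>H\<close>; the converse direction
  multiplies by the inverse of \<open>h\<close>. This makes indicators of right cosets invariant in
  the sense used below.\<close>

lemma rcoset_mem_mult_iff:
  assumes "subgroup H G" "C \<in> rcosets H" "h \<in> H" "s \<in> carrier G"
  shows "h \<otimes> s \<in> C \<longleftrightarrow> s \<in> C"
proof -
  interpret H: subgroup H G by fact
  have *: "k \<otimes> t \<in> C" if "k \<in> H" "t \<in> C" for k t
    using assms(2) that by (fastforce simp: RCOSETS_def r_coset_def simp flip: m_assoc)
  show ?thesis
  proof
    assume "h \<otimes> s \<in> C"
    from *[OF H.m_inv_closed[OF \<open>h \<in> H\<close>] this] show "s \<in> C"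
      using assms by (simp flip: m_assoc)
  qed (use * assms in blast)
qed

text \<open>The right cosets partition the group, so only the summand of \<open>H #> s\<close>
  survives, and its representative differs from \<open>s\<close> by a left factor in
  \<open>H\<close>.\<close>

lemma rcosets_invariant_expansion:
  fixes f :: "'a \<Rightarrow> 'c::comm_semiring_1"
  assumes H: "subgroup H G" and fin: "finite (rcosets H)"
    and r: "\<And>C. C \<in> rcosets H \<Longrightarrow> r C \<in> C"
    and f: "\<And>h s. h \<in> H \<Longrightarrow> s \<in> carrier G \<Longrightarrow> f (h \<otimes> s) = f s"
    and s: "s \<in> carrier G"
  shows "f s = (\<Sum>C\<in>rcosets H. f (r C) * of_bool (s \<in> C))"
proof -
  interpret H: subgroup H G by fact
  have C: "H #> s \<in> rcosets H" "s \<in> H #> s"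
    using s H.subset H by (auto intro: rcosetsI rcos_self)
  have "s \<in> C \<longleftrightarrow> C = H #> s" if "C \<in> rcosets H" for C
    using that C rcos_disjoint[OF H] unfolding pairwise_def disjnt_def by blast
  then have "(\<Sum>C\<in>rcosets H. f (r C) * of_bool (s \<in> C))
      = (\<Sum>C\<in>rcosets H. if C = H #> s then f (r C) else 0)"
    by (intro sum.cong) auto
  also have "\<dots> = f (r (H #> s))"
    using fin C by simp
  also have "\<dots> = f s"
    using r[OF C(1)] f s by (auto simp: r_coset_def)
  finally show ?thesis ..
qed

end

section \<open>Topology of cosets\<close>

context locally_compact_group
begin

lemma continuous_map_right_mult:
  assumes "a \<in> carrier G"
  shows "continuous_map T T (\<lambda>s. s \<otimes> a)"
  using continuous_map_compose[OF continuous_map_pairedI[OF continuous_map_id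
        continuous_map_const[THEN iffD2]] continuous_mult, of a] assms
  by (simp add: topspace_eq o_def)

text \<open>Writing a translate of \<open>S\<close> as a preimage under right multiplication lets
  continuity carry both openness and closedness over to cosets.\<close>

lemma rcoset_eq_vimage:
  assumes "S \<subseteq> carrier G" "a \<in> carrier G"
  shows "S #> a = {s \<in> topspace T. s \<otimes> inv a \<in> S}"
proof (intro equalityI subsetI)
  fix s assume "s \<in> S #> a"
  then show "s \<in> {s \<in> topspace T. s \<otimes> inv a \<in> S}"
    using assms by (auto simp: r_coset_def topspace_eq m_assoc subset_iff)
next
  fix s assume "s \<in> {s \<in> topspace T. s \<otimes> inv a \<in> S}"
  then show "s \<in> S #> a"
    using assms by (auto simp: r_coset_def topspace_eq m_assoc intro!: bexI[of _ "s \<otimes> inv a"])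
qed

lemma openin_rcoset:
  assumes "openin T S" "a \<in> carrier G"
  shows "openin T (S #> a)"
  using assms openin_subset[OF assms(1)]
    openin_continuous_map_preimage[OF continuous_map_right_mult[of "inv a"] assms(1)]
  by (simp add: rcoset_eq_vimage topspace_eq)

lemma closedin_rcoset:
  assumes "closedin T S" "a \<in> carrier G"
  shows "closedin T (S #> a)"
  using assms closedin_subset[OF assms(1)]
    closedin_continuous_map_preimage[OF continuous_map_right_mult[of "inv a"] assms(1)]
  by (simp add: rcoset_eq_vimage topspace_eq)

text \<open>The complement of \<open>H\<close> is the union of the other cosets, a finite union of
  closed sets.\<close>

lemma openin_closed_subgroup_finite_index:
  assumes H: "subgroup H G" and cl: "closedin T H" and fin: "finite (rcosets H)"
  shows "openin T H"
proof -
  interpret H: subgroup H G by fact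
  have H_rcos: "H \<in> rcosets H"
    using rcosetsI[OF H.subset one_closed] by (simp add: coset_mult_one H.subset)
  have "H \<inter> \<Union>(rcosets H - {H}) = {}"
    using rcos_disjoint[OF H] H_rcos unfolding pairwise_def disjnt_def by blast
  moreover have "\<Union>(rcosets H) = topspace T"
    using rcosets_part_G[OF H] by (simp add: topspace_eq)
  ultimately have "H = topspace T - \<Union>(rcosets H - {H})"
    using H_rcos by blast
  moreover have "closedin T (\<Union>(rcosets H - {H}))"
    using fin by (intro closedin_Union) (auto simp: RCOSETS_def closedin_rcoset[OF cl])
  ultimately show ?thesis
    by (metis openin_diff openin_topspace)
qed

text \<open>Each \<open>s\<close> has the open neighbourhood \<open>H #> s\<close>, on which
  \<open>f\<close> is constant, so the preimage of any set is a union of open cosets. It serves for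
  scalar functions and for the maps \<open>s\<close> to \<open>left_translate X act s F\<close>
  alike.\<close>

lemma continuous_map_rcosets_invariant:
  assumes H: "subgroup H G" and op: "openin T H"
    and f: "\<And>h s. h \<in> H \<Longrightarrow> s \<in> carrier G \<Longrightarrow> f (h \<otimes> s) = f s"
    and Y: "\<And>s. s \<in> carrier G \<Longrightarrow> f s \<in> topspace Y"
  shows "continuous_map T Y f"
  unfolding continuous_map_def
proof (intro conjI allI impI)
  show "f \<in> topspace T \<rightarrow> topspace Y"
    using Y by (auto simp: topspace_eq)
  fix U assume "openin Y U"
  show "openin T {s \<in> topspace T. f s \<in> U}"
  proof (subst openin_subopen, intro ballI)
    fix s assume s: "s \<in> {s \<in> topspace T. f s \<in> U}"
    then have "H #> s \<subseteq> {s \<in> topspace T. f s \<in> U}"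
      using f subgroup.subset[OF H] by (auto simp: r_coset_def topspace_eq)
    then show "\<exists>V. openin T V \<and> s \<in> V \<and> V \<subseteq> {s \<in> topspace T. f s \<in> U}"
      using s openin_rcoset[OF op, of s] rcos_self[OF _ H, of s] by (auto simp: topspace_eq)
  qed
qed

end

section \<open>The action, its kernel and the translation operators\<close>

context G_space
begin

lemma act_closed: "s \<in> carrier G \<Longrightarrow> x \<in> topspace X \<Longrightarrow> act s x \<in> topspace X"
  using continuous_map_funspace[OF continuous_act] by (force simp: topspace_eq)

lemma continuous_map_act_space:
  assumes "s \<in> carrier G"
  shows "continuous_map X X (act s)"
  using continuous_map_compose[OF continuous_map_pairedI[OF
        continuous_map_const[THEN iffD2] continuous_map_id] continuous_act, of s] assms
  by (simp add: topspace_eq o_def)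

lemma continuous_map_act_group:
  assumes "x \<in> topspace X"
  shows "continuous_map T X (\<lambda>s. act s x)"
  using continuous_map_compose[OF continuous_map_pairedI[OF continuous_map_id
        continuous_map_const[THEN iffD2]] continuous_act, of x] assms
  by (simp add: o_def)

lemma subgroup_act_kernel: "subgroup (act_kernel G X act) G"
proof (rule subgroupI)
  fix s assume s: "s \<in> act_kernel G X act"
  then have "act (inv s) x = x" if "x \<in> topspace X" for x
    using that act_mult[of "inv s" s x] act_one[of x] by (auto simp: act_kernel_def)
  then show "inv s \<in> act_kernel G X act"
    using s by (auto simp: act_kernel_def)
qed (auto simp: act_kernel_def act_mult act_one intro!: exI[of _ \<one>])

text \<open>The kernel is the intersection of the stabilizers of the points, each closed because
  \<open>X\<close> is Hausdorff.\<close>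

lemma closedin_act_kernel: "closedin T (act_kernel G X act)"
proof (cases "topspace X = {}")
  \<comment> \<open>An intersection over no points would be the whole type instead of the carrier,
    so the empty space is treated apart.\<close>
  case True
  then show ?thesis
    using closedin_topspace[of T] by (simp add: act_kernel_def topspace_eq)
next
  case False
  have "closedin T {s \<in> topspace T. act s x = x}" if "x \<in> topspace X" for x
    using closedin_continuous_maps_eq[OF Hausdorff_X continuous_map_act_group
        continuous_map_const[THEN iffD2]] that by blast
  then have "closedin T (\<Inter>x\<in>topspace X. {s \<in> topspace T. act s x = x})"
    using False by blast
  moreover have "act_kernel G X act = (\<Inter>x\<in>topspace X. {s \<in> topspace T. act s x = x})"
    using False unfolding act_kernel_def topspace_eq by blast
  ultimately show ?thesis by simp
qed

lemma left_translate_Cb: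
  assumes s: "s \<in> carrier G" and F: "F \<in> mspace (C\<^sub>b X)"
  shows "left_translate X act s F \<in> mspace (C\<^sub>b X)"
proof -
  have "continuous_map X euclidean (left_translate X act s F)"
    using continuous_map_compose[OF continuous_map_act_space[OF s], of euclidean F] F
    unfolding mspace_Cb_iff left_translate_def by (auto intro: continuous_map_eq)
  moreover have "left_translate X act s F ` topspace X \<subseteq> F ` topspace X"
    using act_closed[OF s] by (auto simp: left_translate_def)
  ultimately show ?thesis
    using F bounded_subset unfolding mspace_Cb_iff by (auto simp: left_translate_def)
qed

text \<open>Since \<open>act s\<close> maps \<open>X\<close> into itself, translation does not
  increase the supremum distance: it is Lipschitz with constant 1.\<close>

lemma continuous_map_left_translate_Cb:
  assumes s: "s \<in> carrier G"
  shows "continuous_map (mtopology_of (C\<^sub>b X)) (mtopology_of (C\<^sub>b X)) (left_translate X act s)"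
proof (rule Lipschitz_continuous_imp_continuous_map)
  have "mdist (C\<^sub>b X) (left_translate X act s F) (left_translate X act s H) \<le> 1 * mdist (C\<^sub>b X) F H"
    if "F \<in> mspace (C\<^sub>b X)" "H \<in> mspace (C\<^sub>b X)" for F H
  proof (rule mdist_cfunspace_le)
    show "0 \<le> 1 * mdist (C\<^sub>b X) F H"
      by simp
    fix x assume "x \<in> topspace X"
    then show "mdist euclidean_metric (left_translate X act s F x) (left_translate X act s H x)
        \<le> 1 * mdist (C\<^sub>b X) F H"
      using mdist_cfunspace_imp_mdist_le[OF that order_refl act_closed[OF s]]
      by (simp add: left_translate_def)
  qed
  then show "Lipschitz_continuous_map (C\<^sub>b X) (C\<^sub>b X) (left_translate X act s)"
    unfolding Lipschitz_continuous_map_def using left_translate_Cb[OF s] by blast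
qed

text \<open>The element \<open>h\<close> fixes the point \<open>act s x\<close>. Hence translation
  by \<open>s\<close> depends only on the right coset of \<open>s\<close>.\<close>

lemma left_translate_act_kernel:
  assumes "h \<in> act_kernel G X act" "s \<in> carrier G"
  shows "left_translate X act (h \<otimes> s) F = left_translate X act s F"
  unfolding left_translate_def
  by (rule restrict_ext) (use assms act_closed in \<open>auto simp: act_kernel_def act_mult\<close>)

text \<open>With this equality, closure of the domain under sums, multiples and translates reduces
  to that of \<open>mspace (C\<^sub>b X)\<close>.\<close>

lemma LUC_eq_Cb:
  assumes "openin T (act_kernel G X act)"
  shows "LUC T X act = mspace (C\<^sub>b X)"
proof -
  have "continuous_map T (mtopology_of (C\<^sub>b X)) (\<lambda>s. left_translate X act s F)"
    if F: "F \<in> mspace (C\<^sub>b X)" for F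
    using continuous_map_rcosets_invariant[OF subgroup_act_kernel assms]
      left_translate_act_kernel left_translate_Cb[OF _ F] by (metis topspace_mtopology_of)
  then show ?thesis
    unfolding LUC_def by blast
qed

end

section \<open>Coset-invariant functions on the group and functionals applied to them\<close>

text \<open>Such a function has at most one value per coset, so it is bounded, and it is locally
  constant. By associativity its left translates by \<open>h \<otimes> s\<close> and by
  \<open>s\<close> agree, so the translation map is locally constant too.\<close>

lemma (in locally_compact_group) rcosets_invariant_LUC:
  assumes H: "subgroup H G" and op: "openin T H" and fin: "finite (rcosets H)"
    and f: "\<And>h s. h \<in> H \<Longrightarrow> s \<in> carrier G \<Longrightarrow> f (h \<otimes> s) = f s"
  shows "(\<lambda>s\<in>carrier G. f s) \<in> LUC_group G T"
proof -
  interpret left: G_space G T T "(\<otimes>)"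
    by (rule left_translation_G_space)
  interpret H: subgroup H G by fact
  define F where "F = (\<lambda>s\<in>carrier G. f s)"
  have "\<exists>C\<in>rcosets H. f s = f (SOME t. t \<in> C)" if s: "s \<in> carrier G" for s
  proof (intro bexI)
    show "H #> s \<in> rcosets H"
      using s H.subset by (intro rcosetsI)
    have "(SOME t. t \<in> H #> s) \<in> H #> s"
      using rcos_self[OF s H] by (rule someI)
    then show "f s = f (SOME t. t \<in> H #> s)"
      using f s by (auto simp: r_coset_def)
  qed
  then have "F ` topspace T \<subseteq> (\<lambda>C. f (SOME t. t \<in> C)) ` (rcosets H)"
    by (auto simp: F_def topspace_eq)
  then have "bounded (F ` topspace T)"
    using fin by (meson finite_imp_bounded finite_imageI finite_subset)
  moreover have "continuous_map T euclidean F"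
    by (rule continuous_map_rcosets_invariant[OF H op]) (auto simp: F_def f)
  ultimately have F: "F \<in> mspace (C\<^sub>b T)"
    unfolding mspace_Cb_iff by (simp add: F_def topspace_eq)
  have "left_translate T (\<otimes>) (h \<otimes> s) F = left_translate T (\<otimes>) s F"
    if "h \<in> H" "s \<in> carrier G" for h s
    unfolding left_translate_def
    by (rule restrict_ext) (use that f in \<open>auto simp: F_def topspace_eq m_assoc\<close>)
  then have "continuous_map T (mtopology_of (C\<^sub>b T)) (\<lambda>s. left_translate T (\<otimes>) s F)"
    using continuous_map_rcosets_invariant[OF H op] left.left_translate_Cb[OF _ F]
    by (metis topspace_mtopology_of)
  with F show ?thesis
    unfolding LUC_def F_def by blast
qed

text \<open>This is \<open>m\<close> applied term by term to the expansion of \<open>f\<close> in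
  coset indicators.\<close>

lemma (in locally_compact_group) dual_rcosets_invariant:
  assumes H: "subgroup H G" and op: "openin T H" and fin: "finite (rcosets H)"
    and r: "\<And>C. C \<in> rcosets H \<Longrightarrow> r C \<in> C"
    and f: "\<And>h s. h \<in> H \<Longrightarrow> s \<in> carrier G \<Longrightarrow> f (h \<otimes> s) = f s"
    and m: "m \<in> dual T (LUC_group G T)"
  shows "m (\<lambda>s\<in>carrier G. f s) =
    (\<Sum>C\<in>rcosets H. f (r C) * m (\<lambda>s\<in>carrier G. of_bool (s \<in> C)))"
proof -
  define one where "one C = (\<lambda>s\<in>carrier G. of_bool (s \<in> C) :: complex)" for C
  note LUCI = rcosets_invariant_LUC[OF H op fin]
  have one: "one C \<in> LUC_group G T" if "C \<in> rcosets H" for C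
    unfolding one_def by (rule LUCI) (use that rcoset_mem_mult_iff[OF H] in simp)
  have add: "m (\<lambda>s\<in>carrier G. F s + K s) = m F + m K"
    if "F \<in> LUC_group G T" "K \<in> LUC_group G T" for F K
    using m that by (simp add: dual_def topspace_eq)
  have cmult: "m (\<lambda>s\<in>carrier G. c * F s) = c * m F" if "F \<in> LUC_group G T" for c F
    using m that by (simp add: dual_def topspace_eq)
  \<comment> \<open>Linearity of \<open>m\<close> is available only within
    \<open>LUC_group G T\<close>, so the induction runs over sets of cosets and checks that every
    partial sum stays invariant.\<close>
  have "m (\<lambda>s\<in>carrier G. \<Sum>C\<in>A. f (r C) * of_bool (s \<in> C)) = (\<Sum>C\<in>A. f (r C) * m (one C))"
    if "A \<subseteq> rcosets H" for A
    using finite_subset[OF that fin] that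
  proof (induction A rule: finite_induct)
    case empty
    have "(\<lambda>s\<in>carrier G. 0) \<in> LUC_group G T"
      by (rule LUCI) simp
    \<comment> \<open>Scaling the zero function by 0 shows that \<open>m\<close> vanishes on
      it.\<close>
    from cmult[OF this, of 0] show ?case by (simp add: restrict_def)
  next
    case (insert D A)
    \<comment> \<open>Keeping \<open>one D\<close> folded gives \<open>F\<close> the exact shape of
      a scalar multiple to which \<open>cmult\<close> applies.\<close>
    define F where "F = (\<lambda>s\<in>carrier G. f (r D) * one D s)"
    define K where "K = (\<lambda>s\<in>carrier G. \<Sum>C\<in>A. f (r C) * of_bool (s \<in> C))"
    have F: "F \<in> LUC_group G T"
      unfolding F_def
      by (rule LUCI) (use insert.prems rcoset_mem_mult_iff[OF H] subgroup.mem_carrier[OF H]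
          in \<open>simp add: one_def\<close>)
    have K: "K \<in> LUC_group G T"
      unfolding K_def
      by (rule LUCI, intro sum.cong) (use insert.prems rcoset_mem_mult_iff[OF H] in auto)
    have "(\<lambda>s\<in>carrier G. \<Sum>C\<in>insert D A. f (r C) * of_bool (s \<in> C)) = (\<lambda>s\<in>carrier G. F s + K s)"
      using insert.hyps by (intro restrict_ext) (simp add: F_def K_def one_def)
    moreover have "m K = (\<Sum>C\<in>A. f (r C) * m (one C))"
      unfolding K_def using insert.IH insert.prems by blast
    moreover have "m F = f (r D) * m (one D)"
      unfolding F_def using insert.prems one by (intro cmult) auto
    ultimately show ?case
      by (simp only: add[OF F K] sum.insert[OF insert.hyps])
  qed
  from this[OF order_refl] show ?thesis
    using rcosets_invariant_expansion[OF H fin r f] by (simp add: one_def cong: restrict_cong)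
qed

section \<open>The product of functionals when the kernel has finite index\<close>

context G_space
begin

text \<open>The value of \<open>M\<close> at the translate of \<open>F\<close> by \<open>s\<close>
  depends only on the coset of \<open>s\<close>, so \<open>m\<close> can be evaluated by the coset
  expansion. The coefficients depend neither on \<open>M\<close> nor on \<open>F\<close>.\<close>

lemma functional_mult_finite_index:
  assumes fin: "finite (rcosets (act_kernel G X act))"
    and r: "\<And>C. C \<in> rcosets (act_kernel G X act) \<Longrightarrow> r C \<in> C"
    and m: "m \<in> dual T (LUC_group G T)" and F: "F \<in> LUC T X act"
  shows "functional_mult T X act m M F =
    (\<Sum>C\<in>rcosets (act_kernel G X act).
      m (\<lambda>s\<in>carrier G. of_bool (s \<in> C)) * M (left_translate X act (r C) F))"
  using dual_rcosets_invariant[where r = r and f = "\<lambda>s. M (left_translate X act s F)",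
      OF subgroup_act_kernel openin_closed_subgroup_finite_index[OF subgroup_act_kernel
      closedin_act_kernel fin] fin r _ m] F
  by (simp add: functional_mult_def functional_fun_def topspace_eq left_translate_act_kernel
      mult.commute)

text \<open>The weak* topology lives on the dual, so the product must be seen to land there.
  Linearity and norm continuity pass from \<open>M\<close> through the translations to the finite
  sum.\<close>

lemma functional_mult_dual:
  assumes fin: "finite (rcosets (act_kernel G X act))"
    and m: "m \<in> dual T (LUC_group G T)" and M: "M \<in> dual X (LUC T X act)"
  shows "functional_mult T X act m M \<in> dual X (LUC T X act)"
proof -
  let ?N = "act_kernel G X act"
  have LUC: "LUC T X act = mspace (C\<^sub>b X)"
    using LUC_eq_Cb openin_closed_subgroup_finite_index subgroup_act_kernel closedin_act_kernel fin
    by blast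
  define r where "r C = (SOME s. s \<in> C)" for C :: "'g set"
  have r: "r C \<in> C" if "C \<in> rcosets ?N" for C
    using subgroup.rcosets_non_empty[OF subgroup_act_kernel that] by (simp add: r_def some_in_eq)
  have rG: "r C \<in> carrier G" if "C \<in> rcosets ?N" for C
    using r[OF that] rcosets_part_G[OF subgroup_act_kernel] that by blast
  define a where "a C = m (\<lambda>s\<in>carrier G. of_bool (s \<in> C))" for C
  have mult: "functional_mult T X act m M F =
      (\<Sum>C\<in>rcosets ?N. a C * M (left_translate X act (r C) F))" if "F \<in> mspace (C\<^sub>b X)" for F
    unfolding a_def using functional_mult_finite_index[OF fin r m] that LUC by blast
  have trans: "left_translate X act s F \<in> mspace (C\<^sub>b X)"
    if "s \<in> carrier G" "F \<in> mspace (C\<^sub>b X)" for s F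
    using left_translate_Cb that .
  have M_add: "M (\<lambda>x\<in>topspace X. F x + H x) = M F + M H"
    if "F \<in> mspace (C\<^sub>b X)" "H \<in> mspace (C\<^sub>b X)" for F H
    using M that unfolding dual_def LUC by blast
  have M_cmult: "M (\<lambda>x\<in>topspace X. c * F x) = c * M F" if "F \<in> mspace (C\<^sub>b X)" for c F
    using M that unfolding dual_def LUC by blast
  \<comment> \<open>Here \<open>LUC T X act\<close> is the whole space, so the subtopology in
    \<open>dual\<close> is the full metric topology. Dropping \<open>mspace_cfunspace\<close> keeps
    \<open>mspace (C\<^sub>b X)\<close> folded.\<close>
  have M_cont: "continuous_map (mtopology_of (C\<^sub>b X)) euclidean M"
    using M unfolding dual_def LUC
    by (simp add: subtopology_superset del: mspace_cfunspace)
  have "functional_mult T X act m M (\<lambda>x\<in>topspace X. F x + H x) =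
      functional_mult T X act m M F + functional_mult T X act m M H"
    if FH: "F \<in> mspace (C\<^sub>b X)" "H \<in> mspace (C\<^sub>b X)" for F H
  proof -
    \<comment> \<open>The restricted sum is evaluated at \<open>act s x\<close>, which lies in
      \<open>X\<close>, so the restriction does no harm.\<close>
    have "left_translate X act s (\<lambda>x\<in>topspace X. F x + H x) =
        (\<lambda>x\<in>topspace X. left_translate X act s F x + left_translate X act s H x)"
      if "s \<in> carrier G" for s
      using act_closed[OF that] by (auto simp: left_translate_def)
    then have "M (left_translate X act s (\<lambda>x\<in>topspace X. F x + H x)) =
        M (left_translate X act s F) + M (left_translate X act s H)" if "s \<in> carrier G" for s
      using M_add trans FH that by metis
    then show ?thesis
      using rG by (simp add: mult FH Cb_add distrib_left sum.distrib del: mspace_cfunspace)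
  qed
  moreover have "functional_mult T X act m M (\<lambda>x\<in>topspace X. c * F x) =
      c * functional_mult T X act m M F" if F: "F \<in> mspace (C\<^sub>b X)" for c F
  proof -
    have "left_translate X act s (\<lambda>x\<in>topspace X. c * F x) =
        (\<lambda>x\<in>topspace X. c * left_translate X act s F x)" if "s \<in> carrier G" for s
      using act_closed[OF that] by (auto simp: left_translate_def)
    then have "M (left_translate X act s (\<lambda>x\<in>topspace X. c * F x)) =
        c * M (left_translate X act s F)" if "s \<in> carrier G" for s
      using M_cmult trans F that by metis
    then show ?thesis
      using rG by (simp add: mult F Cb_cmult sum_distrib_left mult.left_commute
          del: mspace_cfunspace)
  qed
  moreover have "continuous_map (mtopology_of (C\<^sub>b X)) euclidean (functional_mult T X act m M)"
  proof (rule continuous_map_eq)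
    show "continuous_map (mtopology_of (C\<^sub>b X)) euclidean
        (\<lambda>F. \<Sum>C\<in>rcosets ?N. a C * M (left_translate X act (r C) F))"
    proof (intro continuous_map_sum fin)
      fix C assume "C \<in> rcosets ?N"
      from continuous_map_compose[OF continuous_map_left_translate_Cb[OF rG[OF this]] M_cont]
      have "continuous_map (mtopology_of (C\<^sub>b X)) euclidean
          ((*) (a C) \<circ> (M \<circ> left_translate X act (r C)))"
        by (rule continuous_map_compose) (auto intro!: continuous_intros)
      then show "continuous_map (mtopology_of (C\<^sub>b X)) euclidean
          (\<lambda>F. a C * M (left_translate X act (r C) F))"
        by (simp add: o_def)
    qed
  qed (simp add: mult del: mspace_cfunspace)
  ultimately show ?thesis
    unfolding dual_def LUC
    by (auto simp: functional_mult_def LUC subtopology_superset simp del: mspace_cfunspace)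
qed

text \<open>Continuity into the weak* topology is tested at each \<open>F\<close>, where the product
  is a finite combination of evaluations of \<open>M\<close> at translates of
  \<open>F\<close>.\<close>

lemma continuous_map_functional_mult:
  assumes fin: "finite (rcosets (act_kernel G X act))" and m: "m \<in> dual T (LUC_group G T)"
  shows "continuous_map (weak_star X (LUC T X act)) (weak_star X (LUC T X act))
    (functional_mult T X act m)"
proof -
  let ?N = "act_kernel G X act" and ?V = "LUC T X act"
  have LUC: "?V = mspace (C\<^sub>b X)"
    using LUC_eq_Cb openin_closed_subgroup_finite_index subgroup_act_kernel closedin_act_kernel fin
    by blast
  define r where "r C = (SOME s. s \<in> C)" for C :: "'g set"
  have r: "r C \<in> C" if "C \<in> rcosets ?N" for C
    using subgroup.rcosets_non_empty[OF subgroup_act_kernel that] by (simp add: r_def some_in_eq)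
  have "continuous_map (weak_star X ?V) euclidean (\<lambda>M. functional_mult T X act m M F)"
    if F: "F \<in> ?V" for F
  proof -
    define a where "a C = m (\<lambda>s\<in>carrier G. of_bool (s \<in> C))" for C
    have "continuous_map (weak_star X ?V) euclidean
        (\<lambda>M. \<Sum>C\<in>rcosets ?N. a C * M (left_translate X act (r C) F))"
    proof (intro continuous_map_sum fin)
      fix C assume C: "C \<in> rcosets ?N"
      then have "r C \<in> carrier G"
        using r[OF C] rcosets_part_G[OF subgroup_act_kernel] by blast
      \<comment> \<open>Evaluation at the translate is a coordinate projection only because the
        translate is again an index in \<open>?V\<close>.\<close>
      then have "left_translate X act (r C) F \<in> ?V"
        using left_translate_Cb F unfolding LUC by blast
      then have "continuous_map (weak_star X ?V) euclidean (\<lambda>M. M (left_translate X act (r C) F))"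
        unfolding weak_star_def
        by (intro continuous_map_from_subtopology continuous_map_product_projection)
      then have "continuous_map (weak_star X ?V) euclidean
          ((*) (a C) \<circ> (\<lambda>M. M (left_translate X act (r C) F)))"
        by (rule continuous_map_compose) (auto intro!: continuous_intros)
      then show "continuous_map (weak_star X ?V) euclidean
          (\<lambda>M. a C * M (left_translate X act (r C) F))"
        by (simp add: o_def)
    qed
    then show ?thesis
      using functional_mult_finite_index[OF fin r m F] unfolding a_def by simp
  qed
  moreover have "topspace (weak_star X ?V) \<subseteq> dual X ?V"
    by (simp add: weak_star_def)
  then have "functional_mult T X act m \<in> topspace (weak_star X ?V) \<rightarrow> dual X ?V"
    using functional_mult_dual[OF fin m] by blast
  ultimately show ?thesis
    \<comment> \<open>Only the target topology is unfolded, into a coordinatewise condition and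
      membership in the dual.\<close>
    by (subst (2) weak_star_def)
      (auto simp: continuous_map_in_subtopology continuous_map_componentwise functional_mult_def)
qed

end

theorem proposition4p5:
  fixes G :: "('g, 'b) monoid_scheme" and T :: "'g topology"
    and X :: "'x topology" and act :: "'g \<Rightarrow> 'x \<Rightarrow> 'x"
  assumes "locally_compact_group G T"
    and "G_space G T X act"
    and "finite (rcosets\<^bsub>G\<^esub> (act_kernel G X act))"
  shows "topological_centre G T X act = dual T (LUC_group G T)"
  \<comment> \<open>The centre lies in the dual by definition; the cited fact supplies the weak*
    continuity for every \<open>m\<close>.\<close>
  using G_space.continuous_map_functional_mult[OF assms(2,3)]
  unfolding topological_centre_def by blast

end
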